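(* Let $q>3$ be a prime and let $r$ be a positive divisor of $q-1$. Then $G(3q,r)=G(3q;r,2,u)$, where $u=r$ if $r$ is even, and $u=2r$ if $r$ is odd.
   Context: $H(q,r)$ is the unique subgroup of order $r$ of $\mathbb{Z}_q^*$. The graph $G(3q,r)$ has vertex set $\mathbb{Z}_3\times\mathbb{Z}_q$ and edge set $\{\{(i,x),(i+1,y)\}: i\in\mathbb{Z}_3,\ x,y\in\mathbb{Z}_q,\ y-x\in H(q,r)\}$. For primes $p<q$, an even divisor $s$ of $p-1$ and a divisor $r$ of $q-1$, let $H(p,s)=\langle a\rangle\le\mathbb{Z}_p^*$ be the subgroup of order $s$, let $t\in\mathbb{Z}_q^*$ be such that $t^{s/2}\in -H(q,r)$, and let $u=\mathrm{lcm}(r,o(t))$ where $o(t)$ is the order of $t$ in $\mathbb{Z}_q^*$. The graph $G(pq;r,s,u)$ has vertex set $\mathbb{Z}_p\times\mathbb{Z}_q$, with $(i,x)$ and $(j,y)$ adjacent iff there is an integer $l$ such that $j-i=a^l$ and $y-x\in t^lH(q,r)$. Here $p=3$ and $s=2$, so $a=-1$ and $t\in -H(q,r)$. *)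

theory Defs
  imports "HOL-Number_Theory.Number_Theory"
begin

abbreviation Zring :: "nat \<Rightarrow> int ring" where
  "Zring n \<equiv> residue_ring (int n)"

abbreviation Zunits :: "nat \<Rightarrow> int monoid" where
  "Zunits n \<equiv> units_of (residue_ring (int n))"

text \<open>The description below is proper for \<open>q\<close> prime and \<open>r\<close> dividing \<open>q - 1\<close>;
  see \<open>ex1_subgroup_of_order\<close>.\<close>

definition Hsub :: "nat \<Rightarrow> nat \<Rightarrow> int set" where
  "Hsub q r = (THE H. subgroup H (Zunits q) \<and> card H = r)"

text \<open>A (simple, undirected) graph is a pair of a vertex set and a set of two-element vertex sets.\<close>

type_synonym 'v ugraph = "'v set \<times> 'v set set"

definition G3 :: "nat \<Rightarrow> nat \<Rightarrow> (int \<times> int) ugraph" where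
  "G3 q r =
    (carrier (Zring 3) \<times> carrier (Zring q),
     {{(i, x), (i \<oplus>\<^bsub>Zring 3\<^esub> \<one>\<^bsub>Zring 3\<^esub>, y)} | i x y.
        i \<in> carrier (Zring 3) \<and> x \<in> carrier (Zring q) \<and> y \<in> carrier (Zring q) \<and>
        y \<ominus>\<^bsub>Zring q\<^esub> x \<in> Hsub q r})"

text \<open>The conditions on the parameters of \<open>G(pq; r, s, u)\<close>, including the auxiliary
  choices \<open>a\<close> and \<open>t\<close>, which the notation suppresses.\<close>

definition Gpq_params ::
  "nat \<Rightarrow> nat \<Rightarrow> nat \<Rightarrow> nat \<Rightarrow> nat \<Rightarrow> int \<Rightarrow> int \<Rightarrow> bool" where
  "Gpq_params p q r s u a t \<longleftrightarrow>
     prime p \<and> prime q \<and> p < q \<and>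
     even s \<and> s dvd p - 1 \<and> r dvd q - 1 \<and>
     a \<in> carrier (Zunits p) \<and> Hsub p s = generate (Zunits p) {a} \<and>
     t \<in> carrier (Zunits q) \<and>
     t [^]\<^bsub>Zunits q\<^esub> (s div 2) \<in> (\<lambda>h. \<ominus>\<^bsub>Zring q\<^esub> h) ` Hsub q r \<and>
     u = lcm r (group.ord (Zunits q) t)"

definition Gpq_adj ::
  "nat \<Rightarrow> nat \<Rightarrow> nat \<Rightarrow> int \<Rightarrow> int \<Rightarrow> int \<times> int \<Rightarrow> int \<times> int \<Rightarrow> bool" where
  "Gpq_adj p q r a t v w \<longleftrightarrow>
     (\<exists>l::int. snd w \<ominus>\<^bsub>Zring q\<^esub> snd v \<in> (t [^]\<^bsub>Zunits q\<^esub> l) <#\<^bsub>Zunits q\<^esub> Hsub q r \<and>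
               fst w \<ominus>\<^bsub>Zring p\<^esub> fst v = a [^]\<^bsub>Zunits p\<^esub> l)"

text \<open>The parameters \<open>s\<close> and \<open>u\<close> are determined by \<open>a\<close> and \<open>(r, t)\<close> through
  \<^const>\<open>Gpq_params\<close>. The adjacency relation is symmetric under these conditions
  (\<open>Gpq_adj_sym\<close>), so a pair of vertices is an edge iff it is adjacent
  (\<open>Gpq_edge_iff\<close>).\<close>

definition Gpq :: "nat \<Rightarrow> nat \<Rightarrow> nat \<Rightarrow> int \<Rightarrow> int \<Rightarrow> (int \<times> int) ugraph" where
  "Gpq p q r a t =
    (carrier (Zring p) \<times> carrier (Zring q),
     {{v, w} | v w.
        v \<in> carrier (Zring p) \<times> carrier (Zring q) \<and>
        w \<in> carrier (Zring p) \<times> carrier (Zring q) \<and>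
        Gpq_adj p q r a t v w})"


lemma field_Zring:
  assumes "prime q" shows "field (Zring q)"
proof -
  interpret residues_prime q "Zring q" by unfold_locales (use assms in auto)
  show ?thesis by (rule is_field)
qed

lemma ex1_subgroup_of_order:
  assumes q: "prime q" and r: "r dvd q - 1"
  shows "\<exists>!H. subgroup H (Zunits q) \<and> card H = r"
proof -
  let ?R = "Zring q" and ?G = "Zunits q"
  interpret residues_prime q ?R by unfold_locales (use q in auto)
  interpret G: comm_group ?G by (rule units_comm_group)
  have mo: "mult_of ?R = ?G" by (rule field.mult_of_is_Units[OF is_field])
  have fin: "finite (carrier ?G)" by (simp add: units_of_carrier)
  have ord: "order ?G = q - 1"
    by (simp add: Coset.order_def units_of_carrier res_prime_units_eq)
  have q1: "q - 1 > 0" using prime_gt_1_nat[OF q] by simp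
  have r0: "r > 0" using r q1 by (metis dvd_0_left_iff gr0I less_numeral_extra(3))
  obtain g where g: "g \<in> carrier ?G"
    and gen: "carrier ?G = {g [^]\<^bsub>?R\<^esub> i | i::nat. i \<in> UNIV}"
    using finite_field_mult_group_has_gen[OF finite] unfolding mo by blast
  have "g [^]\<^bsub>?R\<^esub> i = g [^]\<^bsub>?G\<^esub> i" for i :: nat
    using g units_of_pow by (simp add: units_of_carrier)
  hence "carrier ?G = {g [^]\<^bsub>?G\<^esub> i | i::nat. i \<in> UNIV}" using gen by simp
  hence "carrier ?G = generate ?G {g}" using G.generate_pow_on_finite_carrier[OF fin g] by simp
  hence og: "G.ord g = q - 1" using G.generate_pow_card[OF g] ord by (simp add: Coset.order_def)
  define h where "h = g [^]\<^bsub>?G\<^esub> ((q - 1) div r)"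
  have h: "h \<in> carrier ?G" using g by (simp add: h_def)
  obtain k where k: "q - 1 = r * k" using r by (rule dvdE)
  have k0: "k \<noteq> 0" "(q - 1) div r = k" using k q1 r0 by (auto intro!: Nat.gr0I)
  have oh: "G.ord h = r"
    unfolding h_def using G.ord_pow_gen[OF g, of k] og k k0 by simp
  have sub: "H = {x \<in> carrier ?R. x [^]\<^bsub>?R\<^esub> r = \<one>\<^bsub>?R\<^esub>}"
    if H: "subgroup H ?G" and c: "card H = r" for H
  proof (rule card_seteq)
    show "finite {x \<in> carrier ?R. x [^]\<^bsub>?R\<^esub> r = \<one>\<^bsub>?R\<^esub>}" by simp
    show "card {x \<in> carrier ?R. x [^]\<^bsub>?R\<^esub> r = \<one>\<^bsub>?R\<^esub>} \<le> card H"
      unfolding c using num_roots_le_deg[OF finite, of r] r0 by auto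
    show "H \<subseteq> {x \<in> carrier ?R. x [^]\<^bsub>?R\<^esub> r = \<one>\<^bsub>?R\<^esub>}"
    proof
      fix x assume x: "x \<in> H"
      have xG: "x \<in> carrier ?G" using subgroup.mem_carrier[OF H x] .
      interpret HG: group "?G\<lparr>carrier := H\<rparr>" by (rule subgroup.subgroup_is_group[OF H G.is_group])
      have "x [^]\<^bsub>?G\<lparr>carrier := H\<rparr>\<^esub> r = \<one>\<^bsub>?G\<^esub>"
        using HG.pow_order_eq_1[of x] x c by (simp add: Coset.order_def)
      hence "x [^]\<^bsub>?G\<^esub> r = \<one>\<^bsub>?G\<^esub>" using G.nat_pow_consistent by metis
      thus "x \<in> {x \<in> carrier ?R. x [^]\<^bsub>?R\<^esub> r = \<one>\<^bsub>?R\<^esub>}"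
        using xG units_of_pow[of x r] by (auto simp: units_of_carrier units_of_one)
    qed
  qed
  have "subgroup (generate ?G {h}) ?G" using G.generate_is_subgroup h by simp
  moreover have "card (generate ?G {h}) = r" using G.generate_pow_card[OF h] oh by simp
  ultimately show ?thesis using sub by (metis (no_types, lifting))
qed

lemma Hsub_props:
  assumes "prime q" and "r dvd q - 1"
  shows "subgroup (Hsub q r) (Zunits q)" and "card (Hsub q r) = r"
  using theI'[OF ex1_subgroup_of_order[OF assms]] unfolding Hsub_def by auto

lemma Zunits_neg:
  assumes q: "prime q" and x: "x \<in> carrier (Zunits q)"
  shows "\<ominus>\<^bsub>Zring q\<^esub> x \<in> carrier (Zunits q)"
    and "x \<otimes>\<^bsub>Zunits q\<^esub> (\<ominus>\<^bsub>Zring q\<^esub> \<one>\<^bsub>Zring q\<^esub>) = \<ominus>\<^bsub>Zring q\<^esub> x"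
proof -
  interpret F: field "Zring q" by (rule field_Zring[OF q])
  have "x \<in> carrier (Zring q)" using x F.Units_closed by (simp add: units_of_carrier)
  thus "x \<otimes>\<^bsub>Zunits q\<^esub> (\<ominus>\<^bsub>Zring q\<^esub> \<one>\<^bsub>Zring q\<^esub>) = \<ominus>\<^bsub>Zring q\<^esub> x"
    by (simp add: units_of_mult F.r_minus)
  show "\<ominus>\<^bsub>Zring q\<^esub> x \<in> carrier (Zunits q)"
    using x by (simp add: units_of_carrier F.field_Units)
qed

lemma Gpq_adj_sym:
  assumes par: "Gpq_params p q r s u a t"
    and v: "v \<in> carrier (Zring p) \<times> carrier (Zring q)"
    and w: "w \<in> carrier (Zring p) \<times> carrier (Zring q)"
    and adj: "Gpq_adj p q r a t v w"
  shows "Gpq_adj p q r a t w v"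
proof -
  let ?P = "Zunits p" and ?Q = "Zunits q" and ?H = "Hsub q r"
  from par have p: "prime p" and q: "prime q" and s: "even s" "s dvd p - 1" and r: "r dvd q - 1"
    and a: "a \<in> carrier ?P" and gen: "Hsub p s = generate ?P {a}" and t: "t \<in> carrier ?Q"
    unfolding Gpq_params_def by auto
  obtain h0 where h0: "h0 \<in> ?H" and th0: "t [^]\<^bsub>?Q\<^esub> (s div 2) = \<ominus>\<^bsub>Zring q\<^esub> h0"
    using par unfolding Gpq_params_def by auto
  obtain l :: int where l1: "snd w \<ominus>\<^bsub>Zring q\<^esub> snd v \<in> (t [^]\<^bsub>?Q\<^esub> l) <#\<^bsub>?Q\<^esub> ?H"
    and l2: "fst w \<ominus>\<^bsub>Zring p\<^esub> fst v = a [^]\<^bsub>?P\<^esub> l"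
    using adj unfolding Gpq_adj_def by auto
  then obtain h where h: "h \<in> ?H" and lh: "snd w \<ominus>\<^bsub>Zring q\<^esub> snd v = t [^]\<^bsub>?Q\<^esub> l \<otimes>\<^bsub>?Q\<^esub> h"
    unfolding l_coset_def by auto
  interpret Fp: field "Zring p" by (rule field_Zring[OF p])
  interpret Fq: field "Zring q" by (rule field_Zring[OF q])
  interpret P: comm_group ?P by (rule Fp.units_comm_group)
  interpret Q: comm_group ?Q by (rule Fq.units_comm_group)
  interpret H: subgroup ?H ?Q by (rule Hsub_props[OF q r])
  have s0: "s > 0" using s prime_gt_1_nat[OF p] by (auto intro!: Nat.gr0I)
  have oa: "P.ord a = s" using P.generate_pow_card[OF a] gen Hsub_props(2)[OF p s(2)] by simp
  define b where "b = a [^]\<^bsub>?P\<^esub> (s div 2)"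
  have b: "b \<in> carrier ?P" using a by (simp add: b_def)
  have bR: "b \<in> carrier (Zring p)" using b Fp.Units_closed by (simp add: units_of_carrier)
  have "b \<otimes>\<^bsub>?P\<^esub> b = a [^]\<^bsub>?P\<^esub> s"
    unfolding b_def using a s(1) by (simp add: P.nat_pow_mult) (metis even_two_times_div_two mult_2)
  also have "\<dots> = \<one>\<^bsub>?P\<^esub>" using P.pow_ord_eq_1[OF a] oa by simp
  finally have bb: "b \<otimes>\<^bsub>Zring p\<^esub> b = \<one>\<^bsub>Zring p\<^esub>" by (simp add: units_of_mult units_of_one)
  have "\<not> s dvd s div 2" using s0 s(1) by (auto dest!: dvd_imp_le)
  hence "b \<noteq> \<one>\<^bsub>Zring p\<^esub>"
    using P.pow_eq_id[OF a, of "s div 2"] oa by (simp add: b_def units_of_one)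
  hence bm: "b = \<ominus>\<^bsub>Zring p\<^esub> \<one>\<^bsub>Zring p\<^esub>" using Fp.square_eq_one[OF bR bb] by auto
  define l' where "l' = l + int (s div 2)"
  have swap: "y \<ominus>\<^bsub>Zring m\<^esub> x = \<ominus>\<^bsub>Zring m\<^esub> (x \<ominus>\<^bsub>Zring m\<^esub> y)"
    if "prime m" "x \<in> carrier (Zring m)" "y \<in> carrier (Zring m)" for m x y
  proof -
    interpret F: field "Zring m" by (rule field_Zring[OF that(1)])
    show ?thesis using that(2,3) by (simp add: F.minus_eq F.minus_add F.a_comm)
  qed
  have A: "a [^]\<^bsub>?P\<^esub> l \<in> carrier ?P" using a by simp
  have "a [^]\<^bsub>?P\<^esub> l' = a [^]\<^bsub>?P\<^esub> l \<otimes>\<^bsub>?P\<^esub> b"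
    unfolding l'_def b_def using a by (simp add: P.int_pow_mult int_pow_int)
  also have "\<dots> = \<ominus>\<^bsub>Zring p\<^esub> (a [^]\<^bsub>?P\<^esub> l)" unfolding bm by (rule Zunits_neg[OF p A])
  also have "\<dots> = fst v \<ominus>\<^bsub>Zring p\<^esub> fst w"
    using swap[OF p, of "fst w" "fst v"] l2 v w by auto
  finally have 1: "fst v \<ominus>\<^bsub>Zring p\<^esub> fst w = a [^]\<^bsub>?P\<^esub> l'" by simp
  define k where "k = inv\<^bsub>?Q\<^esub> h0 \<otimes>\<^bsub>?Q\<^esub> h"
  have k: "k \<in> ?H" using h h0 by (simp add: k_def)
  let ?m = "\<ominus>\<^bsub>Zring q\<^esub> \<one>\<^bsub>Zring q\<^esub>"
  have m: "?m \<in> carrier ?Q" using Zunits_neg(1)[OF q Q.one_closed] by (simp add: units_of_one)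
  have T: "t [^]\<^bsub>?Q\<^esub> l \<in> carrier ?Q" using t by simp
  have hc: "h \<in> carrier ?Q" "h0 \<in> carrier ?Q" using h h0 by auto
  have "t [^]\<^bsub>?Q\<^esub> l' = t [^]\<^bsub>?Q\<^esub> l \<otimes>\<^bsub>?Q\<^esub> (h0 \<otimes>\<^bsub>?Q\<^esub> ?m)"
    unfolding l'_def using t th0 Zunits_neg(2)[OF q hc(2)] by (simp add: Q.int_pow_mult int_pow_int)
  hence "t [^]\<^bsub>?Q\<^esub> l' \<otimes>\<^bsub>?Q\<^esub> k = (t [^]\<^bsub>?Q\<^esub> l \<otimes>\<^bsub>?Q\<^esub> h) \<otimes>\<^bsub>?Q\<^esub> ?m \<otimes>\<^bsub>?Q\<^esub> (h0 \<otimes>\<^bsub>?Q\<^esub> inv\<^bsub>?Q\<^esub> h0)"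
    unfolding k_def using T m hc by (simp add: Q.m_ac del: Q.r_inv Q.l_inv)
  also have "\<dots> = \<ominus>\<^bsub>Zring q\<^esub> (t [^]\<^bsub>?Q\<^esub> l \<otimes>\<^bsub>?Q\<^esub> h)"
    using T m hc Zunits_neg[OF q, of "t [^]\<^bsub>?Q\<^esub> l \<otimes>\<^bsub>?Q\<^esub> h"] by simp
  also have "\<dots> = snd v \<ominus>\<^bsub>Zring q\<^esub> snd w"
    using swap[OF q, of "snd w" "snd v"] lh v w by auto
  finally have "snd v \<ominus>\<^bsub>Zring q\<^esub> snd w \<in> (t [^]\<^bsub>?Q\<^esub> l') <#\<^bsub>?Q\<^esub> ?H"
    using k unfolding l_coset_def by (auto intro!: bexI[OF _ k])
  with 1 show ?thesis unfolding Gpq_adj_def by blast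
qed

lemma Gpq_edge_iff:
  assumes "Gpq_params p q r s u a t"
    and "v \<in> carrier (Zring p) \<times> carrier (Zring q)"
    and "w \<in> carrier (Zring p) \<times> carrier (Zring q)"
  shows "{v, w} \<in> snd (Gpq p q r a t) \<longleftrightarrow> Gpq_adj p q r a t v w"
  using Gpq_adj_sym[OF assms(1)] assms(2,3)
  unfolding Gpq_def snd_conv mem_Collect_eq doubleton_eq_iff by blast

end

theory Submission
  imports Defs
begin

text \<open>For \<open>s = 2\<close> the element \<open>a\<close> is \<open>-1\<close> and \<open>t = -h\<close> with \<open>h \<in> H(q,r)\<close>, so \<open>t\<^sup>2 \<in> H(q,r)\<close>: even
  exponents \<open>l\<close> give exactly the arcs \<open>(i,x) \<rightarrow> (i+1,y)\<close> with \<open>y - x \<in> H(q,r)\<close>. Distinct elements of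
  \<open>\<int>\<^sub>3\<close> differ by \<open>\<plusminus>1\<close>, so by symmetry of adjacency these arcs already carry every edge. For \<open>n\<close> a
  multiple of \<open>r\<close> one has \<open>t\<^sup>n = (-1)\<^sup>n\<close>, which determines \<open>lcm(r, o(t))\<close>.\<close>

text \<open>Lagrange's theorem, applied inside the subgroup, whose order is
  \<open>r\<close>.\<close>

lemma Hsub_pow_eq_one:
  assumes q: "prime q" and r: "r dvd q - 1" and h: "h \<in> Hsub q r"
  shows "h [^]\<^bsub>Zunits q\<^esub> r = \<one>\<^bsub>Zunits q\<^esub>"
proof -
  interpret F: field "Zring q" by (rule field_Zring[OF q])
  interpret G: comm_group "Zunits q" by (rule F.units_comm_group)
  interpret H: group "(Zunits q)\<lparr>carrier := Hsub q r\<rparr>"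
    by (rule subgroup.subgroup_is_group[OF Hsub_props(1)[OF q r] G.is_group])
  have "h [^]\<^bsub>(Zunits q)\<lparr>carrier := Hsub q r\<rparr>\<^esub> r = \<one>\<^bsub>Zunits q\<^esub>"
    using H.pow_order_eq_1[of h] h Hsub_props(2)[OF q r] by (simp add: Coset.order_def)
  thus ?thesis using G.nat_pow_consistent by metis
qed

text \<open>The element -1 serves twice: as the witness for both \<open>a\<close> and
  \<open>t\<close>, and as the factor of \<open>t = -h\<close> that decides the parity of exponents.
  The bound \<open>q > 2\<close> keeps -1 apart from 1.\<close>

lemma Zunits_neg_one:
  assumes q: "prime q"
  defines "m \<equiv> \<ominus>\<^bsub>Zring q\<^esub> \<one>\<^bsub>Zring q\<^esub>"
  shows "m \<in> carrier (Zunits q)"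
    and "m \<otimes>\<^bsub>Zunits q\<^esub> m = \<one>\<^bsub>Zunits q\<^esub>"
    and "q > 2 \<Longrightarrow> m \<noteq> \<one>\<^bsub>Zunits q\<^esub>"
    and "q > 2 \<Longrightarrow> group.ord (Zunits q) m = 2"
proof -
  interpret residues_prime q "Zring q" by unfold_locales (use q in auto)
  interpret G: comm_group "Zunits q" by (rule units_comm_group)
  show mc: "m \<in> carrier (Zunits q)"
    using Zunits_neg(1)[OF q G.one_closed] by (simp add: m_def units_of_one)
  show mm: "m \<otimes>\<^bsub>Zunits q\<^esub> m = \<one>\<^bsub>Zunits q\<^esub>"
    by (simp add: m_def units_of_mult units_of_one l_minus)
  show ne: "m \<noteq> \<one>\<^bsub>Zunits q\<^esub>" if "q > 2"
    using that one_eq_neg_one by (auto simp: m_def units_of_one)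
  show "G.ord m = 2" if "q > 2"
  proof -
    have "m [^]\<^bsub>Zunits q\<^esub> (2::nat) = \<one>\<^bsub>Zunits q\<^esub>"
      using mm mc by (simp add: numeral_2_eq_2)
    hence "G.ord m dvd 2" using G.pow_eq_id[OF mc] by simp
    moreover have "G.ord m \<noteq> 1" using ne[OF that] G.ord_eq_1[OF mc] by simp
    ultimately show ?thesis using two_is_prime_nat prime_nat_iff by blast
  qed
qed

lemma lcm_ord_neg:
  assumes q: "prime q" "q > 2" and r: "r > 0" "r dvd q - 1"
    and h: "h \<in> Hsub q r"
  shows "lcm r (group.ord (Zunits q) (\<ominus>\<^bsub>Zring q\<^esub> h)) = (if even r then r else 2 * r)"
proof -
  interpret F: field "Zring q" by (rule field_Zring[OF q(1)])
  interpret G: comm_group "Zunits q" by (rule F.units_comm_group)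
  interpret H: subgroup "Hsub q r" "Zunits q" by (rule Hsub_props[OF q(1) r(2)])
  let ?m = "\<ominus>\<^bsub>Zring q\<^esub> \<one>\<^bsub>Zring q\<^esub>" and ?t = "\<ominus>\<^bsub>Zring q\<^esub> h"
  note m = Zunits_neg_one[OF q(1)]
  have hc: "h \<in> carrier (Zunits q)" using h by simp
  have t: "?t = h \<otimes>\<^bsub>Zunits q\<^esub> ?m" and tc: "?t \<in> carrier (Zunits q)"
    using Zunits_neg[OF q(1) hc] by simp_all
  \<comment> \<open>Multiples of \<open>r\<close> kill the factor \<open>h\<close>, so only the
    power of -1, an element of order 2, remains.\<close>
  have ord_t_dvd: "G.ord ?t dvd n \<longleftrightarrow> even n" if "r dvd n" for n
  proof -
    have "h [^]\<^bsub>Zunits q\<^esub> n = \<one>\<^bsub>Zunits q\<^esub>"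
      using that Hsub_pow_eq_one[OF q(1) r(2) h] G.pow_eq_id[OF hc] dvd_trans by blast
    hence "?t [^]\<^bsub>Zunits q\<^esub> n = ?m [^]\<^bsub>Zunits q\<^esub> n"
      unfolding t using hc m(1) by (simp add: G.pow_mult_distrib G.m_comm)
    thus ?thesis using G.pow_eq_id[OF tc, of n] G.pow_eq_id[OF m(1), of n] m(4)[OF q(2)] by metis
  qed
  \<comment> \<open>Both \<open>r\<close> and the order of \<open>-h\<close> divide
    \<open>2 * r\<close>, so their lcm is \<open>r\<close> or \<open>2 * r\<close>; it is
    \<open>r\<close> exactly when the order divides \<open>r\<close>.\<close>
  have "G.ord ?t dvd 2 * r" using ord_t_dvd by simp
  then obtain k where k: "lcm r (G.ord ?t) = r * k" "r * k dvd r * 2"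
    by (metis dvd_lcm1 dvdE dvd_triv_left lcm_least mult.commute)
  hence "k dvd 2" using r(1) by simp
  hence "k = 1 \<or> k = 2" using two_is_prime_nat prime_nat_iff by blast
  moreover have "k = 1 \<longleftrightarrow> even r"
    using k(1) r(1) ord_t_dvd[of r] lcm_proj1_iff_nat[of r "G.ord ?t"] by auto
  ultimately show ?thesis using k(1) by auto
qed

text \<open>Supplies admissible parameters, so that a statement about all choices of
  \<open>a\<close> and \<open>t\<close> is not vacuous. The order of \<open>t = -1\<close> is 2,
  whence \<open>lcm r 2\<close>.\<close>

lemma Gpq_params_neg_one:
  assumes p: "prime p" "p > 2" and q: "prime q" "p < q" and r: "r dvd q - 1"
  shows "Gpq_params p q r 2 (lcm r 2) (\<ominus>\<^bsub>Zring p\<^esub> \<one>\<^bsub>Zring p\<^esub>) (\<ominus>\<^bsub>Zring q\<^esub> \<one>\<^bsub>Zring q\<^esub>)"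
proof -
  interpret Fp: field "Zring p" by (rule field_Zring[OF p(1)])
  interpret Fq: field "Zring q" by (rule field_Zring[OF q(1)])
  interpret P: comm_group "Zunits p" by (rule Fp.units_comm_group)
  interpret Q: comm_group "Zunits q" by (rule Fq.units_comm_group)
  interpret H: subgroup "Hsub q r" "Zunits q" by (rule Hsub_props[OF q(1) r])
  let ?a = "\<ominus>\<^bsub>Zring p\<^esub> \<one>\<^bsub>Zring p\<^esub>"
  note a = Zunits_neg_one[OF p(1)] and t = Zunits_neg_one[OF q(1)]
  have s: "2 dvd p - 1" using p prime_odd_nat[of p] by simp
  have "subgroup (generate (Zunits p) {?a}) (Zunits p)"
    using P.generate_is_subgroup a(1) by simp
  moreover have "card (generate (Zunits p) {?a}) = 2"
    using P.generate_pow_card[OF a(1)] a(4)[OF p(2)] by simp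
  \<comment> \<open>There is only one subgroup of order 2.\<close>
  ultimately have "Hsub p 2 = generate (Zunits p) {?a}"
    using Hsub_props[OF p(1) s] ex1_subgroup_of_order[OF p(1) s] by blast
  \<comment> \<open>Since \<open>s div 2 = 1\<close>, the condition on \<open>t = -1\<close> is that
    it be the negative of an element of \<open>Hsub q r\<close>; that element is 1.\<close>
  moreover have "\<one>\<^bsub>Zring q\<^esub> \<in> Hsub q r" using H.one_closed by (simp add: units_of_one)
  ultimately show ?thesis
    unfolding Gpq_params_def using p q r s a(1) t(1) t(4) by (auto simp: numeral_2_eq_2)
qed

text \<open>As \<open>a\<close> has order 2, a first-coordinate difference of 1 forces
  \<open>l\<close> to be even; then \<open>t\<close> to the power \<open>l\<close> lies in
  \<open>Hsub q r\<close>, and its coset is the subgroup itself.\<close>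

lemma Gpq_adj_succ_iff:
  assumes par: "Gpq_params p q r 2 u a t"
    and i: "i \<in> carrier (Zring p)"
  shows "Gpq_adj p q r a t (i, x) (i \<oplus>\<^bsub>Zring p\<^esub> \<one>\<^bsub>Zring p\<^esub>, y) \<longleftrightarrow>
    y \<ominus>\<^bsub>Zring q\<^esub> x \<in> Hsub q r" (is "?L \<longleftrightarrow> ?R")
proof -
  let ?P = "Zunits p" and ?Q = "Zunits q" and ?H = "Hsub q r"
  from par have p: "prime p" and q: "prime q" and s: "2 dvd p - 1" and r: "r dvd q - 1"
    and a: "a \<in> carrier ?P" and gen: "Hsub p 2 = generate ?P {a}" and t: "t \<in> carrier ?Q"
    unfolding Gpq_params_def by auto
  interpret Fp: field "Zring p" by (rule field_Zring[OF p])
  interpret Fq: field "Zring q" by (rule field_Zring[OF q])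
  interpret P: comm_group ?P by (rule Fp.units_comm_group)
  interpret Q: comm_group ?Q by (rule Fq.units_comm_group)
  interpret H: subgroup ?H ?Q by (rule Hsub_props[OF q r])
  have oa: "P.ord a = 2" using P.generate_pow_card[OF a] gen Hsub_props(2)[OF p s] by simp
  obtain h where h: "h \<in> ?H" and th: "t = \<ominus>\<^bsub>Zring q\<^esub> h"
    using par t unfolding Gpq_params_def by auto
  have hc: "h \<in> carrier ?Q" using h by simp
  have "t \<otimes>\<^bsub>?Q\<^esub> t = h \<otimes>\<^bsub>?Q\<^esub> h"
    unfolding th using hc Fq.Units_closed
    by (simp add: units_of_mult units_of_carrier Fq.l_minus Fq.r_minus)
  hence tt: "t [^]\<^bsub>?Q\<^esub> (2::int) \<in> ?H"
    using t h int_pow_int[of ?Q t 2] by (simp add: numeral_2_eq_2)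
  have tl: "t [^]\<^bsub>?Q\<^esub> l \<in> ?H" if l: "even l" for l :: int
  proof -
    obtain k where k: "l = 2 * k" using l by auto
    have "t [^]\<^bsub>?Q\<^esub> l = (t [^]\<^bsub>?Q\<^esub> (2::int)) [^]\<^bsub>?Q\<^esub> k"
      unfolding k using t by (simp add: Q.int_pow_pow)
    thus ?thesis using Q.subgroup_int_pow_closed[OF H.subgroup_axioms tt] by simp
  qed
  have diff: "(i \<oplus>\<^bsub>Zring p\<^esub> \<one>\<^bsub>Zring p\<^esub>) \<ominus>\<^bsub>Zring p\<^esub> i = \<one>\<^bsub>?P\<^esub>"
    using i by (simp add: units_of_one Fp.minus_eq Fp.a_comm[of i "\<one>\<^bsub>Zring p\<^esub>"]
        Fp.a_assoc Fp.r_neg)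
  have al: "a [^]\<^bsub>?P\<^esub> l = \<one>\<^bsub>?P\<^esub> \<longleftrightarrow> even l" for l :: int
    using P.int_pow_eq_id[OF a] oa by simp
  have "?L \<longleftrightarrow> (\<exists>l::int. even l \<and> y \<ominus>\<^bsub>Zring q\<^esub> x \<in> (t [^]\<^bsub>?Q\<^esub> l) <#\<^bsub>?Q\<^esub> ?H)"
    unfolding Gpq_adj_def using al diff by (auto simp: eq_commute)
  also have "\<dots> \<longleftrightarrow> (\<exists>l::int. even l \<and> y \<ominus>\<^bsub>Zring q\<^esub> x \<in> ?H)"
    using tl Q.coset_join3[OF _ H.subgroup_axioms] t by (metis Q.int_pow_closed)
  \<comment> \<open>The exponent 0 is an even witness.\<close>
  also have "\<dots> \<longleftrightarrow> ?R" by (auto intro: exI[of _ 0])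
  finally show ?thesis .
qed

text \<open>Here \<open>p = 3\<close> enters: the only units modulo 3 are 1 and -1.\<close>

lemma Zring_3_diff_unit:
  assumes "i \<in> carrier (Zring 3)" "j \<in> carrier (Zring 3)"
    and "j \<ominus>\<^bsub>Zring 3\<^esub> i \<in> carrier (Zunits 3)"
  shows "j = i \<oplus>\<^bsub>Zring 3\<^esub> \<one>\<^bsub>Zring 3\<^esub> \<or> i = j \<oplus>\<^bsub>Zring 3\<^esub> \<one>\<^bsub>Zring 3\<^esub>"
proof -
  interpret residues_prime 3 "Zring 3" by unfold_locales auto
  have "j \<ominus>\<^bsub>Zring 3\<^esub> i \<noteq> \<zero>\<^bsub>Zring 3\<^esub>"
    using assms(3) unfolding units_of_carrier field.field_Units[OF is_field] by blast
  hence "i \<noteq> j" unfolding r_right_minus_eq[OF assms(2,1)] by blast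
  moreover have "i \<in> {0, 1, 2}" "j \<in> {0, 1, 2}"
    using assms(1,2) by (auto simp: residue_ring_def)
  ultimately show ?thesis by (auto simp: residue_ring_def)
qed

lemma G3_eq_Gpq:
  assumes par: "Gpq_params 3 q r 2 u a t"
  shows "G3 q r = Gpq 3 q r a t"
proof -
  let ?V = "carrier (Zring 3) \<times> carrier (Zring q)"
  interpret F: field "Zring 3" by (rule field_Zring) simp
  interpret P: comm_group "Zunits 3" by (rule F.units_comm_group)
  have a: "a \<in> carrier (Zunits 3)" using par unfolding Gpq_params_def by simp
  note adj_succ = Gpq_adj_succ_iff[OF par]
  have "snd (G3 q r) = snd (Gpq 3 q r a t)"
  proof (intro equalityI subsetI)
    fix e assume "e \<in> snd (G3 q r)"
    then obtain i x y where *: "e = {(i, x), (i \<oplus>\<^bsub>Zring 3\<^esub> \<one>\<^bsub>Zring 3\<^esub>, y)}"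
      "i \<in> carrier (Zring 3)" "x \<in> carrier (Zring q)" "y \<in> carrier (Zring q)"
      "y \<ominus>\<^bsub>Zring q\<^esub> x \<in> Hsub q r"
      unfolding G3_def by auto
    have "(i \<oplus>\<^bsub>Zring 3\<^esub> \<one>\<^bsub>Zring 3\<^esub>, y) \<in> ?V"
      using F.a_closed[OF *(2) F.one_closed] *(4) by blast
    thus "e \<in> snd (Gpq 3 q r a t)"
      using * adj_succ[of i x y] unfolding Gpq_def by auto
  next
    fix e assume "e \<in> snd (Gpq 3 q r a t)"
    then obtain v w where e: "e = {v, w}" and v: "v \<in> ?V" and w: "w \<in> ?V"
      and adj: "Gpq_adj 3 q r a t v w"
      unfolding Gpq_def by auto
    \<comment> \<open>An edge written with its second end as the successor is an edge of
      \<open>G3\<close> by definition.\<close>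
    have dir: "{v, w} \<in> snd (G3 q r)"
      if v: "v \<in> ?V" and w: "w \<in> ?V" and adj: "Gpq_adj 3 q r a t v w"
        and succ: "fst w = fst v \<oplus>\<^bsub>Zring 3\<^esub> \<one>\<^bsub>Zring 3\<^esub>" for v w
    proof -
      obtain i x y where vw: "v = (i, x)" "w = (i \<oplus>\<^bsub>Zring 3\<^esub> \<one>\<^bsub>Zring 3\<^esub>, y)"
        using succ by (metis prod.collapse)
      thus ?thesis using v w adj adj_succ[of i x y] unfolding G3_def by auto
    qed
    \<comment> \<open>The difference is a power of \<open>a\<close>, hence a unit.\<close>
    have "fst w \<ominus>\<^bsub>Zring 3\<^esub> fst v \<in> carrier (Zunits 3)"
      using adj P.int_pow_closed[OF a] unfolding Gpq_adj_def by auto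
    hence "fst w = fst v \<oplus>\<^bsub>Zring 3\<^esub> \<one>\<^bsub>Zring 3\<^esub> \<or> fst v = fst w \<oplus>\<^bsub>Zring 3\<^esub> \<one>\<^bsub>Zring 3\<^esub>"
      using v w by (intro Zring_3_diff_unit) auto
    thus "e \<in> snd (G3 q r)"
      \<comment> \<open>If \<open>v\<close> is the successor of \<open>w\<close>, symmetry of
        adjacency allows exchanging the ends, which leaves the unordered pair unchanged.\<close>
      using dir[OF v w adj] dir[OF w v Gpq_adj_sym[OF par v w adj]]
      unfolding e by (auto simp: insert_commute)
  qed
  thus ?thesis by (simp add: G3_def Gpq_def)
qed

text \<open>The notation for the graph hides \<open>a\<close> and \<open>t\<close>, so the equality
  is claimed for every admissible choice, together with the existence of one.\<close>

theorem lemma4p12: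
  fixes q r u :: nat
  assumes "prime q" and "q > 3" and "r > 0" and "r dvd q - 1"
    and "u = (if even r then r else 2 * r)"
  shows "(\<exists>a t. Gpq_params 3 q r 2 u a t) \<and>
    (\<forall>u' a t. Gpq_params 3 q r 2 u' a t \<longrightarrow> u' = u \<and> G3 q r = Gpq 3 q r a t)"
proof -
  have u': "u' = u" if par: "Gpq_params 3 q r 2 u' a t" for u' a t
  proof -
    interpret F: field "Zring q" by (rule field_Zring[OF assms(1)])
    interpret Q: comm_group "Zunits q" by (rule F.units_comm_group)
    obtain h where "h \<in> Hsub q r" "t = \<ominus>\<^bsub>Zring q\<^esub> h" "u' = lcm r (Q.ord t)"
      using par unfolding Gpq_params_def by auto
    thus ?thesis using lcm_ord_neg[of q r h] assms by auto
  qed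
  \<comment> \<open>Applying \<open>u'\<close> to this instance also identifies
    \<open>lcm r 2\<close> with \<open>u\<close>.\<close>
  have "Gpq_params 3 q r 2 (lcm r 2) (\<ominus>\<^bsub>Zring 3\<^esub> \<one>\<^bsub>Zring 3\<^esub>) (\<ominus>\<^bsub>Zring q\<^esub> \<one>\<^bsub>Zring q\<^esub>)"
    using assms by (intro Gpq_params_neg_one) auto
  thus ?thesis using u' G3_eq_Gpq by metis
qed

end
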